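(* Let $G$ be a graph with $n=n(G)$ vertices, $s=\mathrm{sg}(G)$, and diameter $d=\mathrm{diam}(G)\ge 2$. Then $$1\le \left\lceil s - \frac{1+\sqrt{(2s-1)^2-\frac{8(n-s)}{d-1}}}{2} \right\rceil \le \mathrm{sgc}(G) \le \min\{s - 1, n - s\}.$$
   Context: Graphs are finite and simple; strong geodetic notions are considered for connected graphs. For a graph $G$ and $S\subseteq V(G)$, one fixes for each unordered pair $\{x,y\}$ of distinct vertices of $S$ a single shortest $x,y$-path $\widetilde g(x,y)$; $S$ is a strong geodetic set if for some such choice the union of the vertex sets of the chosen paths equals $V(G)$. $\mathrm{sg}(G)$ is the minimum size of a strong geodetic set; a minimum one is an sg-set. For a strong geodetic set $S$, a set $X\subseteq S$ is a strong geodetic core for $S$ if there exists a choice of fixed shortest paths $\widetilde g(x,y)$ for pairs of $S$ such that $\bigcup_{(u,v)\in X\times S} V(\widetilde g(u,v)) = V(G)$. $\mathrm{sgc}(S)$ is the minimum size of a strong geodetic core for $S$, and $\mathrm{sgc}(G)=\min\{\mathrm{sgc}(S): S \text{ an sg-set of } G\}$. *)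

theory Defs
  imports Complex_Main "Graph_Theory.Graph_Theory"
begin

text \<open>
  Finite simple graphs are represented by the locale \<^locale>\<open>pair_graph\<close>: finite, loop-free,
  symmetric digraphs without parallel arcs, so that an edge \<open>xy\<close> is the pair of arcs
  \<open>(x, y)\<close>, \<open>(y, x)\<close>. Paths are arc lists; the vertex set of a path \<open>p\<close> starting in \<open>x\<close>
  is \<open>set (pawalk_verts x p)\<close>.
\<close>

definition graph_dist :: "'a pair_pre_digraph \<Rightarrow> 'a \<Rightarrow> 'a \<Rightarrow> nat" where
  "graph_dist G x y = (LEAST k. \<exists>p. pre_digraph.awalk (with_proj G) x p y \<and> length p = k)"

definition diam :: "'a pair_pre_digraph \<Rightarrow> nat" where
  "diam G = Max {graph_dist G x y | x y. x \<in> pverts G \<and> y \<in> pverts G}"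

definition shortest_path ::
    "'a pair_pre_digraph \<Rightarrow> 'a \<Rightarrow> ('a \<times> 'a) awalk \<Rightarrow> 'a \<Rightarrow> bool" where
  "shortest_path G x p y \<longleftrightarrow>
     pre_digraph.apath (with_proj G) x p y \<and> length p = graph_dist G x y"

text \<open>
  The choice is one path per unordered pair: \<open>g x y\<close> and \<open>g y x\<close> are the same path traversed
  in opposite directions. On the diagonal, the only shortest path is the trivial one, with
  vertex set \<open>{x}\<close>.
\<close>

definition geodesic_choice ::
    "'a pair_pre_digraph \<Rightarrow> 'a set \<Rightarrow> ('a \<Rightarrow> 'a \<Rightarrow> ('a \<times> 'a) awalk) \<Rightarrow> bool" where
  "geodesic_choice G S g \<longleftrightarrow>
     (\<forall>x\<in>S. \<forall>y\<in>S. shortest_path G x (g x y) y \<and> g y x = rev_path (g x y))"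

definition strong_geodetic_set :: "'a pair_pre_digraph \<Rightarrow> 'a set \<Rightarrow> bool" where
  "strong_geodetic_set G S \<longleftrightarrow> S \<subseteq> pverts G \<and>
     (\<exists>g. geodesic_choice G S g \<and>
       (\<Union>(x, y)\<in>{(x, y). x \<in> S \<and> y \<in> S \<and> x \<noteq> y}. set (pawalk_verts x (g x y))) = pverts G)"

definition sg :: "'a pair_pre_digraph \<Rightarrow> nat" where
  "sg G = (LEAST k. \<exists>S. strong_geodetic_set G S \<and> card S = k)"

definition sg_set :: "'a pair_pre_digraph \<Rightarrow> 'a set \<Rightarrow> bool" where
  "sg_set G S \<longleftrightarrow> strong_geodetic_set G S \<and> card S = sg G"

text \<open>
  The choice \<open>g\<close> below need not be one that witnesses \<open>strong_geodetic_set G S\<close> in advance.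
  The pairs \<open>(u, u)\<close> with \<open>u \<in> X\<close> contribute trivial paths only.
\<close>

definition strong_geodetic_core :: "'a pair_pre_digraph \<Rightarrow> 'a set \<Rightarrow> 'a set \<Rightarrow> bool" where
  "strong_geodetic_core G S X \<longleftrightarrow> strong_geodetic_set G S \<and> X \<subseteq> S \<and>
     (\<exists>g. geodesic_choice G S g \<and>
       (\<Union>(u, v)\<in>X \<times> S. set (pawalk_verts u (g u v))) = pverts G)"

definition sgc_of_set :: "'a pair_pre_digraph \<Rightarrow> 'a set \<Rightarrow> nat" where
  "sgc_of_set G S = (LEAST k. \<exists>X. strong_geodetic_core G S X \<and> card X = k)"

definition sgc :: "'a pair_pre_digraph \<Rightarrow> nat" where
  "sgc G = (LEAST k. \<exists>S. sg_set G S \<and> sgc_of_set G S = k)"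

end

theory Submission
  imports Defs
begin

text \<open>Lower bound: let X be a core of size k = sgc(G) of an sg-set S. Only paths between pairs
  of S that meet X are used. There are k(2s-1-k)/2 such pairs, and each path has at most d-1
  vertices outside S, since both its ends lie in S. Hence 2(n-s) \<le> (d-1)k(2s-1-k)
  (\<open>strong_geodetic_core_card_bound\<close>), and solving this quadratic inequality for k
  gives the stated expression.

  Upper bounds: a path can be read from either end. So all vertices of S but one form a core
  (\<open>strong_geodetic_core_remove_vertex\<close>), and so does a set containing, for each vertex
  outside S, one end of a path through it (\<open>strong_geodetic_core_of_complement\<close>).

  That the lower bound is at least 1 comes down to s < n: deleting an inner vertex of a diametral
  path from the vertex set leaves a strong geodetic set
  (\<open>strong_geodetic_set_remove_vertex\<close>). This also guarantees that sg-sets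
  exist.\<close>

section \<open>Shortest paths, distances and diameter\<close>

lemma length_rev_path [simp]: "length (rev_path p) = length p"
  by (induction p) auto

lemma geodesic_choice_shortest_path:
  assumes "geodesic_choice G S g" "x \<in> S" "y \<in> S"
  shows "shortest_path G x (g x y) y"
  using assms unfolding geodesic_choice_def by blast

lemma strong_geodetic_setE:
  assumes "strong_geodetic_set G S"
  obtains g where "S \<subseteq> pverts G" "geodesic_choice G S g"
    "\<forall>w\<in>pverts G. \<exists>x\<in>S. \<exists>y\<in>S. x \<noteq> y \<and> w \<in> set (pawalk_verts x (g x y))"
proof -
  from assms obtain g where g: "S \<subseteq> pverts G" "geodesic_choice G S g" and
    eq: "(\<Union>(x, y)\<in>{(x, y). x \<in> S \<and> y \<in> S \<and> x \<noteq> y}. set (pawalk_verts x (g x y))) = pverts G"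
    unfolding strong_geodetic_set_def by (elim conjE exE)
  have "\<forall>w\<in>pverts G. \<exists>x\<in>S. \<exists>y\<in>S. x \<noteq> y \<and> w \<in> set (pawalk_verts x (g x y))"
    unfolding eq[symmetric] by fast
  with g show ?thesis by (rule that)
qed

lemma (in pair_wf_digraph) graph_dist_le:
  assumes "awalk x p y"
  shows "graph_dist G x y \<le> length p"
  unfolding graph_dist_def using assms by (auto intro: Least_le)

text \<open>A walk of minimal length is already a path: if it repeated a vertex, cutting out the
  closed segment in between would shorten it.\<close>

lemma (in pair_wf_digraph) shortest_path_exists:
  assumes "x \<rightarrow>\<^sup>*\<^bsub>with_proj G\<^esub> y"
  shows "\<exists>p. shortest_path G x p y"
proof -
  from assms have "\<exists>k p. awalk x p y \<and> length p = k"
    by (auto simp: reachable_awalk)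
  then have "\<exists>p. awalk x p y \<and> length p = graph_dist G x y"
    unfolding graph_dist_def by (rule LeastI_ex)
  then obtain p where p: "awalk x p y" "length p = graph_dist G x y" by blast
  have "distinct (awalk_verts x p)"
  proof (rule ccontr)
    assume "\<not> distinct (awalk_verts x p)"
    then obtain q r t where "p = q @ r @ t" "0 < length r"
      "\<exists>w. awalk x q w \<and> awalk w r w \<and> awalk w t y"
      using awalk_not_distinct_decomp[OF p(1)] by blast
    then have "awalk x (q @ t) y" "length (q @ t) < length p" by auto
    with p(2) graph_dist_le[of x "q @ t" y] show False by linarith
  qed
  with p show ?thesis by (auto simp: shortest_path_def apath_def)
qed

lemma (in pair_sym_digraph) graph_dist_sym: "graph_dist G x y = graph_dist G y x"
proof -
  have "(\<exists>p. awalk x p y \<and> length p = k) \<longleftrightarrow> (\<exists>p. awalk y p x \<and> length p = k)" for k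
    by (metis awalk_rev_path length_rev_path)
  then show ?thesis unfolding graph_dist_def by simp
qed

lemma (in pair_sym_digraph) shortest_path_rev_path:
  "shortest_path G x p y \<Longrightarrow> shortest_path G y (rev_path p) x"
  by (simp add: shortest_path_def graph_dist_sym)

lemma (in pair_sym_digraph) set_pawalk_verts_rev_path:
  assumes "shortest_path G x p y"
  shows "set (pawalk_verts y (rev_path p)) = set (pawalk_verts x p)"
  using assms awalk_verts_rev_path by (auto simp: shortest_path_def apath_def)

lemma (in pair_wf_digraph) shortest_path_verts:
  assumes "shortest_path G x p y"
  shows "set (pawalk_verts x p) \<subseteq> pverts G"
    and "x \<in> set (pawalk_verts x p)" and "y \<in> set (pawalk_verts x p)"
    and "card (set (pawalk_verts x p)) = Suc (graph_dist G x y)"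
proof -
  have ap: "apath x p y" and len: "length p = graph_dist G x y"
    using assms by (auto simp: shortest_path_def)
  then have aw: "awalk x p y" by (simp add: awalkI_apath)
  from aw have last: "awlast x p = y" and sub: "set (pawalk_verts x p) \<subseteq> pverts G"
    by (auto elim!: awalkE)
  show "set (pawalk_verts x p) \<subseteq> pverts G" by (fact sub)
  show "x \<in> set (pawalk_verts x p)" using aw by (rule hd_in_awalk_verts(1))
  show "y \<in> set (pawalk_verts x p)"
    using last_in_set[of "pawalk_verts x p"] last by (cases p) auto
  show "card (set (pawalk_verts x p)) = Suc (graph_dist G x y)"
    using ap len length_awalk_verts by (simp add: apath_def distinct_card)
qed

lemma (in pair_fin_digraph) graph_dist_le_diam:
  assumes "x \<in> pverts G" "y \<in> pverts G"
  shows "graph_dist G x y \<le> diam G"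
proof -
  have "{graph_dist G x y | x y. x \<in> pverts G \<and> y \<in> pverts G}
      = (\<lambda>(x, y). graph_dist G x y) ` (pverts G \<times> pverts G)" by auto
  then have "finite {graph_dist G x y | x y. x \<in> pverts G \<and> y \<in> pverts G}"
    using pair_finite_verts by simp
  then show ?thesis unfolding diam_def using assms by (auto intro!: Max_ge)
qed

lemma (in pair_fin_digraph) diam_attained:
  assumes "pverts G \<noteq> {}"
  obtains x y where "x \<in> pverts G" "y \<in> pverts G" "graph_dist G x y = diam G"
proof -
  have eq: "{graph_dist G x y | x y. x \<in> pverts G \<and> y \<in> pverts G}
      = (\<lambda>(x, y). graph_dist G x y) ` (pverts G \<times> pverts G)" by auto
  have "diam G \<in> {graph_dist G x y | x y. x \<in> pverts G \<and> y \<in> pverts G}"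
    unfolding diam_def eq using pair_finite_verts assms by (intro Max_in) auto
  with that show ?thesis by auto
qed

text \<open>Allows either end of a chosen path to be taken as its start.\<close>

lemma (in pair_sym_digraph) set_pawalk_verts_choice_commute:
  assumes "geodesic_choice G S g" "x \<in> S" "y \<in> S"
  shows "set (pawalk_verts y (g y x)) = set (pawalk_verts x (g x y))"
  using assms set_pawalk_verts_rev_path by (metis geodesic_choice_def)

text \<open>A shortest path has at most \<open>diam G + 1\<close> vertices, and its two distinct
  ends belong to \<open>S\<close>.\<close>

lemma (in pair_fin_digraph) card_inner_verts_choice:
  assumes "geodesic_choice G S g" "x \<in> S" "y \<in> S" "x \<noteq> y" "S \<subseteq> pverts G"
  shows "card (set (pawalk_verts x (g x y)) - S) \<le> diam G - 1"
proof -
  have sp: "shortest_path G x (g x y) y"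
    using assms(1-3) by (rule geodesic_choice_shortest_path)
  have "card (set (pawalk_verts x (g x y)) - S) \<le> card (set (pawalk_verts x (g x y)) - {x, y})"
    using assms by (intro card_mono) auto
  also have "\<dots> = card (set (pawalk_verts x (g x y))) - card {x, y}"
    using shortest_path_verts[OF sp] by (intro card_Diff_subset) auto
  also have "\<dots> = graph_dist G x y - 1"
    using shortest_path_verts(4)[OF sp] assms(4) by simp
  also have "\<dots> \<le> diam G - 1"
    using graph_dist_le_diam[of x y] assms by (intro diff_le_mono) auto
  finally show ?thesis .
qed

section \<open>Strong geodetic sets that omit a vertex\<close>

text \<open>One path may be prescribed because the choices for different unordered pairs are
  independent.\<close>

lemma (in pair_graph) geodesic_choice_extends:
  assumes conn: "strongly_connected (with_proj G)" and S: "S \<subseteq> pverts G"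
    and ab: "a \<noteq> b" and p: "shortest_path G a p b"
  obtains g where "geodesic_choice G S g" "g a b = p"
proof -
  have "\<forall>x\<in>pverts G. \<forall>y\<in>pverts G. \<exists>q. shortest_path G x q y"
    using conn shortest_path_exists by (auto simp: strongly_connected_def)
  then obtain h where h: "\<And>x y. x \<in> pverts G \<Longrightarrow> y \<in> pverts G \<Longrightarrow> shortest_path G x (h x y) y"
    by metis
  \<comment> \<open>The numbering orients each unordered pair, so that \<open>h\<close> is consulted
    in one direction only and the other direction is its reverse.\<close>
  obtain f :: "'a \<Rightarrow> nat" where f: "inj_on f (pverts G)"
    using finite_imp_inj_to_nat_seg[OF pair_finite_verts] by blast
  define g where "g x y =
    (if x = a \<and> y = b then p else if x = b \<and> y = a then rev_path p
     else if x = y then [] else if f x < f y then h x y else rev_path (h y x))" for x y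
  have "shortest_path G x (g x y) y \<and> g y x = rev_path (g x y)" if "x \<in> S" "y \<in> S" for x y
  proof
    have V: "x \<in> pverts G" "y \<in> pverts G" using that S by auto
    have "shortest_path G u [] u" if "u \<in> pverts G" for u
      using graph_dist_le[of u "[]" u] that by (simp add: shortest_path_def apath_Nil_iff awalk_Nil_iff)
    then show "shortest_path G x (g x y) y"
      using V h[of x y] p shortest_path_rev_path[OF p] shortest_path_rev_path[OF h[of y x]]
      by (auto simp: g_def)
    have "f x \<noteq> f y" if "x \<noteq> y" using V f that by (auto dest: inj_onD)
    then show "g y x = rev_path (g x y)"
      using ab by (auto simp: g_def)
  qed
  then have "geodesic_choice G S g" unfolding geodesic_choice_def by blast
  moreover have "g a b = p" by (simp add: g_def)
  ultimately show ?thesis using that by blast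
qed

text \<open>Take \<open>z\<close> inside a shortest path joining two vertices at distance
  \<open>diam G\<close>, and fix that path in the choice: it covers \<open>z\<close>, while every
  other vertex is an end of some chosen path.\<close>

lemma (in pair_graph) strong_geodetic_set_remove_vertex:
  assumes conn: "strongly_connected (with_proj G)" and d: "2 \<le> diam G"
  obtains z where "z \<in> pverts G" "strong_geodetic_set G (pverts G - {z})"
proof -
  have "pverts G \<noteq> {}" using conn by (simp add: strongly_connected_def)
  then obtain a b where ab: "a \<in> pverts G" "b \<in> pverts G" "graph_dist G a b = diam G"
    by (rule diam_attained)
  then have "a \<rightarrow>\<^sup>*\<^bsub>with_proj G\<^esub> b" using conn by (simp add: strongly_connected_def)
  then obtain p where p: "shortest_path G a p b" using shortest_path_exists by blast
  note pv = shortest_path_verts[OF p]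
  \<comment> \<open>The path has \<open>diam G + 1\<close>, hence at least three, vertices.\<close>
  have "card {a, b} < card (set (pawalk_verts a p))"
    using pv(4) ab(3) d by (simp add: card_insert_if)
  then obtain z where z: "z \<in> set (pawalk_verts a p)" "z \<noteq> a" "z \<noteq> b"
    by (metis card_mono finite.emptyI finite.insertI insertCI not_less subsetI)
  have "graph_dist G a a = 0"
    using graph_dist_le[of a "[]" a] ab(1) by (simp add: awalk_Nil_iff)
  with ab d have "a \<noteq> b" by auto
  then obtain g where g: "geodesic_choice G (pverts G - {z}) g" "g a b = p"
    using geodesic_choice_extends[OF conn _ _ p] by (metis Diff_subset)
  have "(\<Union>(x, y)\<in>{(x, y). x \<in> pverts G - {z} \<and> y \<in> pverts G - {z} \<and> x \<noteq> y}.
      set (pawalk_verts x (g x y))) = pverts G" (is "?U = _")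
  proof
    show "?U \<subseteq> pverts G"
      using shortest_path_verts(1)[OF geodesic_choice_shortest_path[OF g(1)]] by blast
    show "pverts G \<subseteq> ?U"
    proof
      fix v assume v: "v \<in> pverts G"
      obtain x y where "x \<in> pverts G - {z}" "y \<in> pverts G - {z}" "x \<noteq> y"
        "v \<in> set (pawalk_verts x (g x y))"
      proof (cases "v = z")
        case True
        then show ?thesis using that[of a b] ab z g \<open>a \<noteq> b\<close> by auto
      next
        case False
        \<comment> \<open>Only pairs of distinct vertices count, so \<open>v\<close> needs a
          partner; one of \<open>a\<close> and \<open>b\<close> always serves.\<close>
        obtain y where y: "y \<in> {a, b}" "v \<noteq> y" using \<open>a \<noteq> b\<close> by auto
        with ab z v False have "shortest_path G v (g v y) y"
          using geodesic_choice_shortest_path[OF g(1)] by auto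
        with that[of v y] y ab z v False show ?thesis
          using shortest_path_verts(2) by auto
      qed
      then show "v \<in> ?U" by auto
    qed
  qed
  with g(1) z pv(1) show ?thesis by (intro that[of z]) (auto simp: strong_geodetic_set_def)
qed

section \<open>Counting the pairs used by a core\<close>

text \<open>From all pairs in \<open>S\<close>, subtract those inside \<open>S - X\<close>. Doubling
  and passing to integers avoids division and truncated subtraction.\<close>

lemma card_two_subsets_meeting:
  assumes "finite S" "X \<subseteq> S"
  shows "2 * int (card {e. e \<subseteq> S \<and> card e = 2 \<and> e \<inter> X \<noteq> {}})
    = int (card X) * (2 * int (card S) - 1 - int (card X))"
proof -
  have two: "2 * int (m choose 2) = int m * (int m - 1)" for m
    by (induction m) (auto simp: numeral_2_eq_2 algebra_simps)
  have fin: "finite {e. e \<subseteq> T \<and> card e = 2}" if "T \<subseteq> S" for T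
    using that assms(1) by (auto intro: finite_subset[of _ "Pow S"])
  have "{e. e \<subseteq> S \<and> card e = 2 \<and> e \<inter> X \<noteq> {}}
      = {e. e \<subseteq> S \<and> card e = 2} - {e. e \<subseteq> S - X \<and> card e = 2}" by auto
  also have "int (card \<dots>) = int (card {e. e \<subseteq> S \<and> card e = 2})
      - int (card {e. e \<subseteq> S - X \<and> card e = 2})"
    using fin by (subst card_Diff_subset) (auto intro!: of_nat_diff card_mono)
  also have "\<dots> = int (card S choose 2) - int (card (S - X) choose 2)"
    using assms by (simp add: n_subsets finite_subset)
  finally have "2 * int (card {e. e \<subseteq> S \<and> card e = 2 \<and> e \<inter> X \<noteq> {}})
      = 2 * int (card S choose 2) - 2 * int (card (S - X) choose 2)" by simp
  moreover have "int (card (S - X)) = int (card S) - int (card X)"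
    using assms by (simp add: card_Diff_subset finite_subset card_mono of_nat_diff)
  ultimately show ?thesis unfolding two by (simp add: algebra_simps)
qed

text \<open>Outside \<open>S\<close>, only the \<open>diam G - 1\<close> inner vertices of a path can be new, and a core \<open>X\<close>
  uses one path per two-element subset of \<open>S\<close> meeting \<open>X\<close>.\<close>

lemma (in pair_graph) strong_geodetic_core_card_bound:
  assumes core: "strong_geodetic_core G S X"
  shows "2 * (int (card (pverts G)) - int (card S))
    \<le> int (diam G - 1) * (int (card X) * (2 * int (card S) - 1 - int (card X)))"
proof -
  define E where "E = {e. e \<subseteq> S \<and> card e = 2 \<and> e \<inter> X \<noteq> {}}"
  obtain g where SV: "S \<subseteq> pverts G" and XS: "X \<subseteq> S" and g: "geodesic_choice G S g"
    and cov: "(\<Union>(u, v)\<in>X \<times> S. set (pawalk_verts u (g u v))) = pverts G"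
    using core by (auto simp: strong_geodetic_core_def strong_geodetic_set_def)
  have finS: "finite S" using SV pair_finite_verts finite_subset by blast
  have finE: "finite E" using finS unfolding E_def by (auto intro: finite_subset[of _ "Pow S"])
  \<comment> \<open>Joining both directions makes \<open>W\<close> a function of the unordered pair;
    the two contributions coincide.\<close>
  define W where "W e = (\<Union>x\<in>e. \<Union>y\<in>e - {x}. set (pawalk_verts x (g x y)) - S)" for e
  have W: "W {x, y} = set (pawalk_verts x (g x y)) - S" if "x \<in> S" "y \<in> S" "x \<noteq> y" for x y
    using set_pawalk_verts_choice_commute[OF g that(1,2)] that(3) by (auto simp: W_def)
  have "card (W e) \<le> diam G - 1" if "e \<in> E" for e
    using that W card_inner_verts_choice[OF g _ _ _ SV] by (auto simp: E_def card_2_iff)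
  then have *: "(\<Sum>e\<in>E. card (W e)) \<le> card E * (diam G - 1)"
    using sum_bounded_above[of E "\<lambda>e. card (W e)" "diam G - 1"] by simp
  have "pverts G - S \<subseteq> (\<Union>e\<in>E. W e)"
  proof
    fix w assume w: "w \<in> pverts G - S"
    then obtain u v where uv: "u \<in> X" "v \<in> S" "w \<in> set (pawalk_verts u (g u v))"
      using cov by blast
    have "shortest_path G u (g u v) v"
      using geodesic_choice_shortest_path[OF g] uv XS by blast
    \<comment> \<open>A diagonal pair contributes only \<open>u\<close>, which lies in
      \<open>S\<close>, whereas \<open>w\<close> does not.\<close>
    then have "u \<noteq> v"
      using uv w XS apath_nonempty_ends[of u "g u v" v]
      by (cases "g u v = []") (auto simp: shortest_path_def)
    then have "{u, v} \<in> E" "w \<in> W {u, v}" using uv w XS W by (auto simp: E_def)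
    then show "w \<in> (\<Union>e\<in>E. W e)" by blast
  qed
  moreover have "finite (W e)" if "e \<in> E" for e
    using that finS by (auto simp: W_def E_def dest: finite_subset)
  ultimately have "card (pverts G - S) \<le> card (\<Union>e\<in>E. W e)"
    using finE by (intro card_mono finite_UN_I) auto
  also have "\<dots> \<le> (\<Sum>e\<in>E. card (W e))" using finE by (rule card_UN_le)
  also note *
  finally have "card (pverts G - S) \<le> card E * (diam G - 1)" .
  then have "int (card (pverts G - S)) \<le> int (diam G - 1) * int (card E)"
    by (metis of_nat_le_iff of_nat_mult mult.commute)
  moreover have "int (card (pverts G - S)) = int (card (pverts G)) - int (card S)"
    using SV finS pair_finite_verts by (simp add: card_Diff_subset of_nat_diff card_mono)
  ultimately have "2 * (int (card (pverts G)) - int (card S)) \<le> int (diam G - 1) * (2 * int (card E))"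
    by (simp add: mult.left_commute[of _ 2])
  then show ?thesis
    unfolding E_def card_two_subsets_meeting[OF finS XS] .
qed

section \<open>Small cores\<close>

text \<open>Every vertex lies on the path of a pair of distinct vertices, at least one of which is
  not \<open>x\<close>; read the path from that end.\<close>

lemma (in pair_graph) strong_geodetic_core_remove_vertex:
  assumes S: "strong_geodetic_set G S" and x: "x \<in> S"
  shows "strong_geodetic_core G S (S - {x})"
proof -
  obtain g where "S \<subseteq> pverts G" and g: "geodesic_choice G S g"
    and cov: "\<forall>w\<in>pverts G. \<exists>x\<in>S. \<exists>y\<in>S. x \<noteq> y \<and> w \<in> set (pawalk_verts x (g x y))"
    using S by (rule strong_geodetic_setE)
  have "(\<Union>(u, v)\<in>(S - {x}) \<times> S. set (pawalk_verts u (g u v))) = pverts G" (is "?U = _")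
  proof
    show "?U \<subseteq> pverts G"
      using shortest_path_verts(1)[OF geodesic_choice_shortest_path[OF g]] by blast
    show "pverts G \<subseteq> ?U"
    proof
      fix w assume "w \<in> pverts G"
      then obtain u v where uv: "u \<in> S" "v \<in> S" "u \<noteq> v" "w \<in> set (pawalk_verts u (g u v))"
        using cov by blast
      show "w \<in> ?U"
      proof (cases "u = x")
        case True
        then show ?thesis using uv set_pawalk_verts_choice_commute[OF g uv(1,2)] by blast
      next
        case False
        then show ?thesis using uv by blast
      qed
    qed
  qed
  with S g show ?thesis unfolding strong_geodetic_core_def by blast
qed

text \<open>One endpoint of a path through each vertex outside \<open>S\<close> suffices: the vertices of \<open>S\<close> are
  then endpoints of the paths from any core vertex.\<close>

lemma (in pair_graph) strong_geodetic_core_of_complement: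
  assumes S: "strong_geodetic_set G S" and ne: "S \<noteq> pverts G"
  obtains X where "strong_geodetic_core G S X" "card X \<le> card (pverts G - S)"
proof -
  obtain g where SV: "S \<subseteq> pverts G" and g: "geodesic_choice G S g"
    and cov: "\<forall>w\<in>pverts G. \<exists>x\<in>S. \<exists>y\<in>S. x \<noteq> y \<and> w \<in> set (pawalk_verts x (g x y))"
    using S by (rule strong_geodetic_setE)
  have "\<forall>w\<in>pverts G. \<exists>u. u \<in> S \<and> (\<exists>v\<in>S. w \<in> set (pawalk_verts u (g u v)))"
    using cov by fast
  from bchoice[OF this] obtain c where
    c: "\<And>w. w \<in> pverts G \<Longrightarrow> c w \<in> S \<and> (\<exists>v\<in>S. w \<in> set (pawalk_verts (c w) (g (c w) v)))"
    by blast
  define X where "X = c ` (pverts G - S)"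
  have XS: "X \<subseteq> S" using c by (auto simp: X_def)
  \<comment> \<open>A vertex outside \<open>S\<close> makes \<open>X\<close> nonempty; the paths
    starting at \<open>x\<close> will cover all of \<open>S\<close>.\<close>
  obtain x where x: "x \<in> X" using ne SV by (auto simp: X_def)
  note sp = geodesic_choice_shortest_path[OF g]
  have "(\<Union>(u, v)\<in>X \<times> S. set (pawalk_verts u (g u v))) = pverts G" (is "?U = _")
  proof
    have "set (pawalk_verts u (g u v)) \<subseteq> pverts G" if "u \<in> X" "v \<in> S" for u v
      using sp XS that by (intro shortest_path_verts(1)) auto
    then show "?U \<subseteq> pverts G" by blast
    show "pverts G \<subseteq> ?U"
    proof
      fix w assume w: "w \<in> pverts G"
      show "w \<in> ?U"
      proof (cases "w \<in> S")
        case True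
        then have "w \<in> set (pawalk_verts x (g x w))"
          using x XS by (intro shortest_path_verts(3) sp) auto
        then show ?thesis using x True by blast
      next
        case False
        obtain v where "v \<in> S" "w \<in> set (pawalk_verts (c w) (g (c w) v))"
          using c[OF w] by blast
        moreover have "c w \<in> X" using w False by (simp add: X_def)
        ultimately show ?thesis by blast
      qed
    qed
  qed
  then have "strong_geodetic_core G S X"
    using S XS g unfolding strong_geodetic_core_def by blast
  moreover have "card X \<le> card (pverts G - S)"
    unfolding X_def using pair_finite_verts by (intro card_image_le) auto
  ultimately show ?thesis by (rule that)
qed

lemma sgc_le_card_core:
  assumes "sg_set G S" "strong_geodetic_core G S X"
  shows "sgc G \<le> card X"
proof -
  have "sgc G \<le> sgc_of_set G S" unfolding sgc_def using assms(1) by (auto intro: Least_le)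
  also have "\<dots> \<le> card X" unfolding sgc_of_set_def using assms(2) by (auto intro: Least_le)
  finally show ?thesis .
qed

text \<open>Both nested minima are attained once their index sets are nonempty. The minimizing
  sg-set is not known beforehand, so the existence of a core is assumed for every sg-set.\<close>

lemma sgc_attained:
  assumes "sg_set G S" "\<And>S. sg_set G S \<Longrightarrow> \<exists>X. strong_geodetic_core G S X"
  obtains S X where "sg_set G S" "strong_geodetic_core G S X" "card X = sgc G"
proof -
  have "\<exists>k S. sg_set G S \<and> sgc_of_set G S = k" using assms(1) by blast
  then have "\<exists>S. sg_set G S \<and> sgc_of_set G S = sgc G" unfolding sgc_def by (rule LeastI_ex)
  then obtain S where S: "sg_set G S" "sgc_of_set G S = sgc G" by blast
  have "\<exists>k X. strong_geodetic_core G S X \<and> card X = k" using assms(2)[OF S(1)] by blast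
  then have "\<exists>X. strong_geodetic_core G S X \<and> card X = sgc_of_set G S"
    unfolding sgc_of_set_def by (rule LeastI_ex)
  with S that show ?thesis by auto
qed

section \<open>Solving the quadratic inequality\<close>

theorem theorem3p2:
  fixes G :: "'a pair_pre_digraph" and n s d :: nat
  assumes "pair_graph G"
    and "connected (with_proj G)"
    and "n = card (pverts G)"
    and "s = sg G"
    and "d = diam G"
    and "d \<ge> 2"
  shows "1 \<le> \<lceil>real s - (1 + sqrt ((2 * real s - 1)\<^sup>2
             - 8 * (real n - real s) / (real d - 1))) / 2\<rceil>
    \<and> \<lceil>real s - (1 + sqrt ((2 * real s - 1)\<^sup>2
             - 8 * (real n - real s) / (real d - 1))) / 2\<rceil> \<le> int (sgc G)
    \<and> int (sgc G) \<le> min (int s - 1) (int n - int s)"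
proof -
  interpret pair_graph G by fact
  have conn: "strongly_connected (with_proj G)"
    using symmetric_connected_imp_strongly_connected[OF pair_sym_arcs assms(2)] .
  then have ne: "pverts G \<noteq> {}" by (simp add: strongly_connected_def)
  have "2 \<le> diam G" using assms(5,6) by simp
  then obtain z where z: "z \<in> pverts G" "strong_geodetic_set G (pverts G - {z})"
    using strong_geodetic_set_remove_vertex[OF conn] by blast
  have "sg G \<le> card (pverts G - {z})" unfolding sg_def using z(2) by (auto intro: Least_le)
  then have sn: "s < n"
    using z(1) pair_finite_verts assms(3,4) card_gt_0_iff[of "pverts G"] by auto
  have "\<exists>k S. strong_geodetic_set G S \<and> card S = k" using z(2) by blast
  then have "\<exists>S. strong_geodetic_set G S \<and> card S = sg G" unfolding sg_def by (rule LeastI_ex)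
  then obtain S where S: "sg_set G S" by (auto simp: sg_set_def)
  have sgS: "strong_geodetic_set G T" "card T = s" "T \<subseteq> pverts G" "finite T" "T \<noteq> {}"
    if "sg_set G T" for T
    using that assms(4) ne pair_finite_verts finite_subset[of T "pverts G"]
    by (auto simp: sg_set_def strong_geodetic_set_def)
  have s1: "1 \<le> s" using sgS[OF S] card_gt_0_iff[of S] by simp
  have core: "\<exists>x. strong_geodetic_core G T (T - {x}) \<and> x \<in> T" if "sg_set G T" for T
    using sgS[OF that] strong_geodetic_core_remove_vertex by blast

  obtain x where "strong_geodetic_core G S (S - {x})" "x \<in> S" using core[OF S] by blast
  then have "sgc G \<le> s - 1"
    using sgc_le_card_core[OF S] sgS[OF S] by fastforce
  moreover have "sgc G \<le> n - s"
  proof -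
    have "S \<noteq> pverts G" using sgS(2)[OF S] sn assms(3) by auto
    then obtain X where "strong_geodetic_core G S X" "card X \<le> card (pverts G - S)"
      using strong_geodetic_core_of_complement[OF sgS(1)[OF S]] by blast
    then show ?thesis
      using sgc_le_card_core[OF S] sgS[OF S] assms(3) by (fastforce simp: card_Diff_subset)
  qed
  \<comment> \<open>The natural-number differences are not truncated, since \<open>1 \<le> s\<close>
    and \<open>s < n\<close>.\<close>
  ultimately have upper: "int (sgc G) \<le> min (int s - 1) (int n - int s)"
    using s1 sn by linarith

  obtain T X where T: "sg_set G T" and X: "strong_geodetic_core G T X" "card X = sgc G"
    using sgc_attained[OF S] core by blast
  define k where "k = real (sgc G)"
  define D where "D = (2 * real s - 1)\<^sup>2 - 8 * (real n - real s) / (real d - 1)"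
  have d1: "real d - 1 > 0" using assms(6) by linarith
  have "2 * (int n - int s) \<le> int (d - 1) * (int (sgc G) * (2 * int s - 1 - int (sgc G)))"
    using strong_geodetic_core_card_bound[OF X(1)] X(2) sgS(2)[OF T] assms(3,5) by simp
  then have "real_of_int (2 * (int n - int s))
      \<le> real_of_int (int (d - 1) * (int (sgc G) * (2 * int s - 1 - int (sgc G))))"
    by (simp only: of_int_le_iff)
  then have "2 * (real n - real s) \<le> (real d - 1) * (k * (2 * real s - 1 - k))"
    using assms(6) by (simp add: k_def of_nat_diff)
  then have "2 * (real n - real s) / (real d - 1) \<le> k * (2 * real s - 1 - k)"
    using d1 by (simp add: divide_le_eq mult.commute)
  moreover have "D = (2 * real s - 1)\<^sup>2 - 4 * (2 * (real n - real s) / (real d - 1))"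
    by (simp add: D_def)
  \<comment> \<open>Completing the square: the left side equals
    \<open>(2 * real s - 1)\<^sup>2 - 4 * (k * (2 * real s - 1 - k))\<close>. In particular
    \<open>D\<close> is nonnegative, so \<open>sqrt D\<close> is a genuine root.\<close>
  ultimately have "((2 * real s - 1) - 2 * k)\<^sup>2 \<le> D"
    by (simp only: power2_eq_square) argo
  then have "(2 * real s - 1) - 2 * k \<le> sqrt D" by (rule real_le_rsqrt)
  then have "real s - (1 + sqrt D) / 2 \<le> k" by (simp add: field_simps)
  then have lower: "\<lceil>real s - (1 + sqrt D) / 2\<rceil> \<le> int (sgc G)"
    by (simp add: k_def ceiling_le_iff)

  \<comment> \<open>Strictness comes from \<open>s < n\<close>; it makes the expression under the
    ceiling positive, hence the ceiling at least 1.\<close>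
  have "D < (2 * real s - 1)\<^sup>2" using sn d1 by (simp add: D_def)
  then have "sqrt D < sqrt ((2 * real s - 1)\<^sup>2)" by (rule real_sqrt_less_mono)
  then have "sqrt D < 2 * real s - 1" using s1 by simp
  then have "0 < real s - (1 + sqrt D) / 2" by (simp add: field_simps)
  then have "1 \<le> \<lceil>real s - (1 + sqrt D) / 2\<rceil>" by linarith
  with lower upper show ?thesis unfolding D_def by blast
qed

end
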